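(* Let $y_{\max}\in(0,\infty]$, $l>-1/2$, and let $g\in C((-\infty,y_{\max}))$ be increasing with $g(y)=0$ for $y\le0$ and $g(y)>0$ for $y>0$. Suppose that $g$ satisfies the estimate $$g(y)\ge c\,y^{n+l}\quad\text{for }0<y<y^\ast$$ with parameters $c>0$, $0<y^\ast\le y_{\max}$, and $0<n<3+l$. Let $y\in C^1([0,\infty))$ with $y(0)=y_0\in(0,y_{\max})$ satisfy the estimate $$y'(r)\le-\frac{m(r)}{r^2}\quad\text{on }[0,\infty),$$ where $$m(r)=4\pi\int_0^r s^{2+2l}g(y(s))\,ds.$$ Then the function $y$ has a unique zero.
   Context: The function $y$ takes values in $(-\infty,y_{\max})$, so that $g(y(s))$ is defined. At $r=0$ the expression $m(r)/r^2$ is understood as its limit for $r\to0$, which is $0$ since $l>-1/2$. "Increasing" means non-decreasing. *)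

theory Defs
  imports "HOL-Analysis.Analysis"
begin

definition mass :: "real \<Rightarrow> (real \<Rightarrow> real) \<Rightarrow> (real \<Rightarrow> real) \<Rightarrow> real \<Rightarrow> real" where
  "mass l g y r = 4 * pi * integral {0..r} (\<lambda>s. s powr (2 + 2 * l) * g (y s))"

text \<open>
  The quotient \<open>m(r) / r\<^sup>2\<close>; its value at \<open>r = 0\<close> is its limit for \<open>r\<close> tending to \<open>0\<close>,
  which is \<open>0\<close> for continuous \<open>g \<circ> y\<close> since \<open>l > -1/2\<close>.
\<close>

definition mass_quot :: "real \<Rightarrow> (real \<Rightarrow> real) \<Rightarrow> (real \<Rightarrow> real) \<Rightarrow> real \<Rightarrow> real" where
  "mass_quot l g y r = (if r = 0 then 0 else mass l g y r / r\<^sup>2)"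

end

theory Submission
  imports Defs
begin

text \<open>
  Since \<open>y' \<le> - m / r\<^sup>2 < 0\<close> for \<open>r > 0\<close>, there is at most one zero. If \<open>y\<close> stayed
  positive, integrating \<open>y' \<le> - m(r) / s\<^sup>2\<close> over \<open>s \<ge> r\<close> would give \<open>y(r) \<ge> m(r) / r\<close>,
  while monotonicity of \<open>g \<circ> y\<close> gives \<open>m(r) \<ge> C g(y(r)) r\<^bsup>3 + 2 l\<^esup>\<close>. Hence \<open>g(y(r))\<close> decays
  like \<open>r\<^bsup>-(2 + 2 l)\<^esup>\<close>, so \<open>y\<close> tends to \<open>0\<close> and eventually
  \<open>1 \<ge> C y(r)\<^bsup>n + l - 1\<^esup> r\<^bsup>2 + 2 l\<^esup>\<close>. Bounding \<open>y(r)\<close> from below by \<open>m(1) / r\<close>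
  (or, if \<open>n + l \<le> 1\<close>, from above by \<open>y(0)\<close>) makes the right-hand side grow like a positive
  power of \<open>r\<close>, because \<open>n < 3 + l\<close>.
\<close>

lemma powr_unbounded:
  fixes C M p r0 :: real
  assumes "C > 0" "p > 0"
  obtains r where "r \<ge> r0" "r > 0" "C * r powr p > M"
proof -
  \<comment> \<open>Chosen so that \<open>C * K\<close> exceeds \<open>M\<close>, while
    \<open>K powr (1 / p)\<close> is the point where the \<open>p\<close>-th power reaches
    \<open>K\<close>.\<close>
  define K where "K = (\<bar>M\<bar> + 1) / C"
  define r where "r = max r0 (K powr (1 / p))"
  have K: "K > 0" using assms by (simp add: K_def)
  then have r: "r \<ge> r0" "r > 0" "r \<ge> K powr (1 / p)"
    by (auto simp: r_def less_max_iff_disj)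
  have "K = (K powr (1 / p)) powr p"
    using K assms by (simp add: powr_powr)
  also have "\<dots> \<le> r powr p"
    using r assms K by (intro powr_mono2) auto
  finally have "C * K \<le> C * r powr p" using assms by simp
  moreover have "C * K = \<bar>M\<bar> + 1" using assms by (simp add: K_def)
  ultimately show ?thesis using that r by fastforce
qed

text \<open>The exponent \<open>2 + 2 * l\<close> is positive, so the integrand is continuous up to
  and including \<open>s = 0\<close>.\<close>

lemma mass_integrable:
  fixes l r :: real
  assumes "l > - 1" "continuous_on {0..} (\<lambda>s. g (y s))"
  shows "(\<lambda>s. s powr (2 + 2 * l) * g (y s)) integrable_on {0..r}"
proof (rule integrable_continuous_real)
  have "continuous_on {0..r} (\<lambda>s. s powr (2 + 2 * l))"
    using assms by (intro continuous_on_powr' continuous_intros) auto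
  moreover have "continuous_on {0..r} (\<lambda>s. g (y s))"
    using assms(2) by (rule continuous_on_subset) auto
  ultimately show "continuous_on {0..r} (\<lambda>s. s powr (2 + 2 * l) * g (y s))"
    by (rule continuous_on_mult)
qed

lemma mass_mono:
  fixes l r R :: real
  assumes "l > - 1" "continuous_on {0..} (\<lambda>s. g (y s))"
    and "\<And>s. s \<ge> 0 \<Longrightarrow> g (y s) \<ge> 0" and "r \<le> R"
  shows "mass l g y r \<le> mass l g y R"
  unfolding mass_def using assms
  by (intro mult_left_mono integral_subset_le mass_integrable) auto

lemma mass_nonneg:
  fixes l r :: real
  assumes "l > - 1" "continuous_on {0..} (\<lambda>s. g (y s))"
    and "\<And>s. s \<ge> 0 \<Longrightarrow> g (y s) \<ge> 0"
  shows "mass l g y r \<ge> 0"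
  unfolding mass_def using assms
  by (intro mult_nonneg_nonneg integral_nonneg mass_integrable) auto

text \<open>Replace \<open>g (y s)\<close> by the constant \<open>b\<close> and integrate the
  remaining power exactly.\<close>

lemma mass_lower_bound:
  fixes l r b :: real
  assumes "l > - 1" "continuous_on {0..} (\<lambda>s. g (y s))" "r \<ge> 0"
    and b: "\<And>s. 0 \<le> s \<Longrightarrow> s \<le> r \<Longrightarrow> b \<le> g (y s)"
  shows "4 * pi / (3 + 2 * l) * b * r powr (3 + 2 * l) \<le> mass l g y r"
proof -
  have "((\<lambda>s. s powr (2 + 2 * l)) has_integral (r powr (2 + 2 * l + 1) / (2 + 2 * l + 1))) {0..r}"
    using assms by (intro has_integral_powr_from_0) auto
  then have I: "((\<lambda>s. s powr (2 + 2 * l) * b) has_integral (r powr (3 + 2 * l) / (3 + 2 * l) * b)) {0..r}"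
    by (intro has_integral_mult_left) (simp add: add.commute add.left_commute)
  have "r powr (3 + 2 * l) / (3 + 2 * l) * b \<le> integral {0..r} (\<lambda>s. s powr (2 + 2 * l) * g (y s))"
    using b by (intro has_integral_le[OF I integrable_integral[OF mass_integrable[where g = g and y = y, OF assms(1,2)]]] mult_left_mono) auto
  then have "4 * pi * (r powr (3 + 2 * l) / (3 + 2 * l) * b) \<le> mass l g y r"
    unfolding mass_def by (intro mult_left_mono) auto
  then show ?thesis by (simp add: mult_ac)
qed

text \<open>The mass is non-decreasing, so beyond \<open>r\<close> it may be frozen at its value at
  \<open>r\<close>. Integrating the resulting bound on \<open>y'\<close> up to \<open>R\<close>,
  dropping \<open>y R\<close>, and letting \<open>R\<close> tend to infinity gives the
  claim.\<close>

lemma nonneg_solution_ge_mass_quotient: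
  fixes l r :: real and g y y' :: "real \<Rightarrow> real"
  assumes "l > - 1" "continuous_on {0..} (\<lambda>s. g (y s))"
    and "\<And>s. s \<ge> 0 \<Longrightarrow> g (y s) \<ge> 0"
    and deriv: "\<And>s. s \<ge> 0 \<Longrightarrow> (y has_real_derivative y' s) (at s within {0..})"
    and ineq: "\<And>s. s \<ge> 0 \<Longrightarrow> y' s \<le> - mass_quot l g y s"
    and y_nonneg: "\<And>s. s \<ge> 0 \<Longrightarrow> y s \<ge> 0"
    and r: "r > 0"
  shows "mass l g y r / r \<le> y r"
proof -
  let ?m = "mass l g y r"
  have le: "?m / r - ?m / R \<le> y r" if R: "R \<ge> r" for R
  proof -
    \<comment> \<open>With \<open>?m\<close> constant, \<open>y s - ?m / s\<close> has derivative
      \<open>y' s + ?m / s\<^sup>2\<close>.\<close>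
    have "y R - ?m / R \<le> y r - ?m / r"
    proof (rule DERIV_nonpos_imp_nonincreasing[OF R])
      fix s assume s: "r \<le> s" "s \<le> R"
      then have "s > 0" using r by simp
      then have "(y has_real_derivative y' s) (at s)"
        using deriv[of s] at_within_interior[of s "{0..}"] by simp
      then have "((\<lambda>s. y s - ?m / s) has_real_derivative (y' s + ?m / s\<^sup>2)) (at s)"
        using \<open>s > 0\<close> by (auto intro!: derivative_eq_intros simp: power2_eq_square)
      moreover have "?m / s\<^sup>2 \<le> mass l g y s / s\<^sup>2"
        using s by (intro divide_right_mono mass_mono[where g = g and y = y, OF assms(1-3)]) auto
      then have "y' s + ?m / s\<^sup>2 \<le> 0"
        using ineq[of s] \<open>s > 0\<close> by (simp add: mass_quot_def)
      ultimately show "\<exists>d. ((\<lambda>s. y s - ?m / s) has_real_derivative d) (at s) \<and> d \<le> 0"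
        by blast
    qed
    then show ?thesis using y_nonneg[of R] R r by linarith
  qed
  have "((\<lambda>R. ?m / r - ?m / R) \<longlongrightarrow> ?m / r - 0) at_top"
    by (intro tendsto_diff tendsto_const tendsto_divide_0[OF tendsto_const]
        filterlim_at_top_imp_at_infinity filterlim_ident)
  then show ?thesis
    using le by (intro tendsto_upperbound[of _ "?m / r - 0" at_top, simplified])
      (auto intro: eventually_mono[OF eventually_ge_at_top[of r]])
qed

theorem lemma3p1:
  fixes ymax ystar :: ereal
    and l c n y0 :: real
    and g y y' :: "real \<Rightarrow> real"
  assumes ymax: "0 < ymax"
    and l: "l > - 1 / 2"
    and g_cont: "continuous_on {x. ereal x < ymax} g"
    and g_mono: "mono_on {x. ereal x < ymax} g"
    and g_zero: "\<And>x. x \<le> 0 \<Longrightarrow> g x = 0"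
    and g_pos: "\<And>x. 0 < x \<Longrightarrow> ereal x < ymax \<Longrightarrow> g x > 0"
    and c: "c > 0"
    and ystar: "0 < ystar" "ystar \<le> ymax"
    and n: "0 < n" "n < 3 + l"
    and g_lower: "\<And>x. 0 < x \<Longrightarrow> ereal x < ystar \<Longrightarrow> g x \<ge> c * x powr (n + l)"
    and y_deriv: "\<And>r. r \<ge> 0 \<Longrightarrow> (y has_real_derivative y' r) (at r within {0..})"
    and y'_cont: "continuous_on {0..} y'"
    and y_range: "\<And>r. r \<ge> 0 \<Longrightarrow> ereal (y r) < ymax"
    and y_init: "y 0 = y0" "0 < y0" "ereal y0 < ymax"
    and y_ineq: "\<And>r. r \<ge> 0 \<Longrightarrow> y' r \<le> - mass_quot l g y r"
  shows "\<exists>!r. r \<ge> 0 \<and> y r = 0"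
proof -
  have l1: "l > - 1" using l by simp
  have y_cont: "continuous_on {0..} y"
    using y_deriv by (intro DERIV_continuous_on) auto
  have gy_cont: "continuous_on {0..} (\<lambda>s. g (y s))"
    by (rule continuous_on_compose2[OF g_cont y_cont]) (use y_range in auto)
  have gy_nonneg: "g (y s) \<ge> 0" if "s \<ge> 0" for s
    using g_zero[of "y s"] g_pos[of "y s"] y_range[OF that] by (cases "y s > 0") auto
  have y_deriv': "(y has_real_derivative y' s) (at s)" if "s > 0" for s
    using y_deriv[of s] at_within_interior[of s "{0..}"] that by simp
  have y_anti: "y t \<le> y s" if "0 \<le> s" "s \<le> t" for s t
  proof (rule DERIV_nonpos_imp_decreasing_open[OF that(2)])
    show "continuous_on {s..t} y"
      using y_cont by (rule continuous_on_subset) (use that in auto)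
    fix x assume x: "s < x" "x < t"
    have "mass_quot l g y x \<ge> 0"
      using mass_nonneg[where g = g and y = y, OF l1 gy_cont gy_nonneg, of x] by (simp add: mass_quot_def)
    then have "y' x \<le> 0" using y_ineq[of x] x that by simp
    then show "\<exists>d. (y has_real_derivative d) (at x) \<and> d \<le> 0"
      using y_deriv'[of x] x that by auto
  qed
  define D where "D = 4 * pi / (3 + 2 * l)"
  have D: "D > 0" using l1 by (simp add: D_def)
  have mass_ge: "D * g (y r) * r powr (3 + 2 * l) \<le> mass l g y r" if "r \<ge> 0" for r
    unfolding D_def
  proof (rule mass_lower_bound[where g = g and y = y, OF l1 gy_cont that])
    fix s assume "0 \<le> s" "s \<le> r"
    then show "g (y r) \<le> g (y s)"
      using y_range y_anti by (intro mono_onD[OF g_mono]) auto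
  qed
  \<comment> \<open>Positivity of \<open>y\<close> near the origin makes the mass strictly positive
    at every positive radius, even where \<open>y\<close> is no longer positive.\<close>
  obtain \<delta> where \<delta>: "\<delta> > 0" "y \<delta> > 0"
  proof -
    have "(y \<longlongrightarrow> y 0) (at_right 0)"
      using y_cont by (auto simp: continuous_on_def intro: tendsto_within_subset)
    then have "eventually (\<lambda>x. y x > 0) (at_right 0)"
      using y_init by (intro order_tendstoD) auto
    then have "eventually (\<lambda>x. x > 0 \<and> y x > 0) (at_right (0::real))"
      by (intro eventually_conj eventually_at_right_less)
    then show ?thesis
      using that eventually_happens'[OF trivial_limit_at_right_real] by blast
  qed
  have mass_pos: "mass l g y r > 0" if "r > 0" for r
  proof -
    define t where "t = min r \<delta>"
    have t: "t > 0" "t \<le> r" "t \<le> \<delta>" using that \<delta> by (auto simp: t_def)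
    have "y t > 0" using y_anti[of t \<delta>] t \<delta> by simp
    then have "0 < D * g (y t) * t powr (3 + 2 * l)"
      using D t g_pos y_range[of t] by simp
    also have "\<dots> \<le> mass l g y t" using mass_ge t by simp
    also have "\<dots> \<le> mass l g y r" using mass_mono[where g = g and y = y, OF l1 gy_cont gy_nonneg t(2)] .
    finally show ?thesis .
  qed
  \<comment> \<open>The origin is excluded because \<open>mass_quot\<close> vanishes there.\<close>
  have y_strict: "y t < y s" if "0 < s" "s < t" for s t
  proof (rule DERIV_neg_imp_decreasing[OF that(2)])
    fix x assume x: "s \<le> x" "x \<le> t"
    then have "x > 0" using that by simp
    then have "mass_quot l g y x > 0" using mass_pos[of x] by (simp add: mass_quot_def)
    then have "y' x < 0" using y_ineq[of x] \<open>x > 0\<close> by simp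
    then show "\<exists>d. (y has_real_derivative d) (at x) \<and> d < 0"
      using y_deriv' \<open>x > 0\<close> by auto
  qed
  have "\<exists>r\<ge>0. y r = 0"
  proof (rule ccontr)
    assume no_zero: "\<not> (\<exists>r\<ge>0. y r = 0)"
    have y_pos: "y r > 0" if "r \<ge> 0" for r
    proof (rule ccontr)
      assume "\<not> y r > 0"
      then have "\<exists>x\<ge>0. x \<le> r \<and> y x = 0"
        using that y_init by (intro IVT2' continuous_on_subset[OF y_cont]) auto
      then show False using no_zero by auto
    qed
    have y_ge: "mass l g y r / r \<le> y r" if "r > 0" for r
      using l1 gy_cont gy_nonneg y_deriv y_ineq less_imp_le[OF y_pos] that
      by (rule nonneg_solution_ge_mass_quotient)
    have gy_decay: "D * g (y r) * r powr (2 + 2 * l) \<le> y r" if "r > 0" for r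
    proof -
      have "r powr (3 + 2 * l) = r * r powr (2 + 2 * l)"
        using that powr_add[of r 1 "2 + 2 * l"] by simp
      then have "D * g (y r) * r powr (2 + 2 * l) = D * g (y r) * r powr (3 + 2 * l) / r"
        using that by simp
      also have "\<dots> \<le> mass l g y r / r"
        using mass_ge that by (intro divide_right_mono) auto
      finally show ?thesis using y_ge[OF that] by simp
    qed
    have y_le: "y r \<le> y0" if "r \<ge> 0" for r
      using y_anti[of 0 r] that y_init by simp
    obtain \<epsilon> where \<epsilon>: "\<epsilon> > 0" "ereal \<epsilon> < ystar"
      using ereal_dense2[OF ystar(1)] by (metis ereal_less(2))
    have g_eps: "g \<epsilon> > 0"
      using \<epsilon> ystar by (intro g_pos) auto
    \<comment> \<open>At this radius \<open>y r0 \<ge> \<epsilon>\<close> would violate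
      \<open>gy_decay\<close>, whose right-hand side is at most \<open>y0\<close>. By monotonicity
      the power estimate for \<open>g\<close> then applies from \<open>r0\<close> on.\<close>
    obtain r0 where r0: "r0 > 0" "D * g \<epsilon> * r0 powr (2 + 2 * l) > y0"
      using powr_unbounded[of "D * g \<epsilon>" "2 + 2 * l" 0 y0] D g_eps l1 by auto
    have "y r0 < \<epsilon>"
    proof (rule ccontr)
      assume "\<not> y r0 < \<epsilon>"
      then have "g \<epsilon> \<le> g (y r0)"
        using y_range[of r0] r0 \<epsilon> ystar by (intro mono_onD[OF g_mono]) auto
      then have "D * g \<epsilon> * r0 powr (2 + 2 * l) \<le> D * g (y r0) * r0 powr (2 + 2 * l)"
        using D by (intro mult_right_mono mult_left_mono) auto
      then show False
        using gy_decay[of r0] y_le[of r0] r0 by simp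
    qed
    \<comment> \<open>Insert the power estimate into \<open>gy_decay\<close> and cancel one factor
      \<open>y r\<close>.\<close>
    have key: "D * c * (y r powr (n + l - 1) * r powr (2 + 2 * l)) \<le> 1" if r: "r \<ge> r0" for r
    proof -
      have pos: "r > 0" "y r > 0" using r r0 y_pos by auto
      have "y r \<le> \<epsilon>" using y_anti[of r0 r] r r0 \<open>y r0 < \<epsilon>\<close> by simp
      then have "ereal (y r) < ystar" using \<epsilon>(2) by (meson ereal_less_eq(3) le_less_trans)
      then have "c * y r powr (n + l) \<le> g (y r)" using g_lower pos by simp
      then have "D * (c * y r powr (n + l)) * r powr (2 + 2 * l) \<le> D * g (y r) * r powr (2 + 2 * l)"
        using D by (intro mult_right_mono mult_left_mono) auto
      then have "D * (c * y r powr (n + l)) * r powr (2 + 2 * l) \<le> y r"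
        using gy_decay[of r] pos by simp
      moreover have "y r powr (n + l) = y r * y r powr (n + l - 1)"
        using pos powr_add[of "y r" 1 "n + l - 1"] by simp
      ultimately have "y r * (D * c * (y r powr (n + l - 1) * r powr (2 + 2 * l))) \<le> y r * 1"
        by (simp add: mult_ac)
      then show ?thesis using pos by (simp only: mult_le_cancel_left_pos)
    qed
    show False
    proof (cases "n + l \<le> 1")
      case True
      \<comment> \<open>The exponent of \<open>y r\<close> is not positive here, so the upper bound
        \<open>y0\<close> on \<open>y r\<close> bounds the power from below.\<close>
      obtain r where r: "r \<ge> r0" "r > 0" "D * c * y0 powr (n + l - 1) * r powr (2 + 2 * l) > 1"
        using powr_unbounded[of "D * c * y0 powr (n + l - 1)" "2 + 2 * l" r0 1] D c l1 y_init by auto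
      have "y0 powr (n + l - 1) \<le> y r powr (n + l - 1)"
        using True y_pos[of r] y_le[of r] r by (intro powr_mono2') auto
      then have "D * c * (y0 powr (n + l - 1) * r powr (2 + 2 * l))
          \<le> D * c * (y r powr (n + l - 1) * r powr (2 + 2 * l))"
        using D c by (intro mult_right_mono mult_left_mono) auto
      then show False using key[OF r(1)] r(3) by (simp add: mult.assoc)
    next
      case False
      \<comment> \<open>Now the exponent is positive and a lower bound on \<open>y r\<close> is
        needed: \<open>a / r\<close> serves for \<open>r \<ge> 1\<close>. The powers of
        \<open>r\<close> combine to \<open>2 + 2 * l - (n + l - 1) = 3 + l - n\<close>, which is
        positive by the upper bound on \<open>n\<close>.\<close>
      define a where "a = mass l g y 1"
      have a: "a > 0" using mass_pos by (simp add: a_def)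
      obtain r where r: "r \<ge> max r0 1" "r > 0" "D * c * a powr (n + l - 1) * r powr (3 + l - n) > 1"
        using powr_unbounded[of "D * c * a powr (n + l - 1)" "3 + l - n" "max r0 1" 1] D c a n by auto
      have "a / r \<le> mass l g y r / r"
        unfolding a_def using r mass_mono[where g = g and y = y, OF l1 gy_cont gy_nonneg]
        by (intro divide_right_mono) auto
      also have "\<dots> \<le> y r" using y_ge r by simp
      finally have "(a / r) powr (n + l - 1) \<le> y r powr (n + l - 1)"
        using False a r by (intro powr_mono2) auto
      then have "D * c * ((a / r) powr (n + l - 1) * r powr (2 + 2 * l))
          \<le> D * c * (y r powr (n + l - 1) * r powr (2 + 2 * l))"
        using D c by (intro mult_right_mono mult_left_mono) auto
      moreover have "(a / r) powr (n + l - 1) * r powr (2 + 2 * l) = a powr (n + l - 1) * r powr (3 + l - n)"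
        using a r powr_diff[of r "2 + 2 * l" "n + l - 1"] by (simp add: powr_divide algebra_simps)
      ultimately show False using key[of r] r by (simp add: mult.assoc)
    qed
  qed
  then obtain r where r: "r \<ge> 0" "y r = 0" by blast
  show ?thesis
  proof (rule ex1I[of _ r])
    fix s assume s: "s \<ge> 0 \<and> y s = 0"
    \<comment> \<open>Since \<open>y 0 = y0 > 0\<close>, no zero lies at the origin, so
      \<open>y_strict\<close> can compare any two zeros.\<close>
    have "s > 0" "r > 0" using r s y_init by (auto simp: less_le)
    then show "s = r"
      using y_strict[of s r] y_strict[of r s] r s by (cases s r rule: linorder_cases) auto
  qed (use r in simp)
qed

end
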